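(* Let $\mathcal{P}^*$ be an equivalence class of $N$-polygons, let $\mathcal{O}\subset\mathcal{P}^*$ be open, let $T_*\in(0,\infty]$, $0<T<T_*$, and let $F:\mathcal{O}\times[0,T_* )\to\mathbb{R}^N$ be continuous and locally Lipschitz in the polygon variable (in the sense of the context). Suppose that for some fixed real number $\mu$ $$\sum_{j=1}^N|\Gamma_j|\,F_j(\Gamma,t)=\mu\qquad(\Gamma\in\mathcal{O},\ t\in[0,T_* )).$$ Let $0=t_0<t_1<\dots<t_{\bar m}\le T$, $\tau_m:=t_{m+1}-t_m$, let $\Gamma_*\in\mathcal{O}$, and let $\Gamma^m\in\mathcal{O}$ $(m=1,2,\dots,\bar m)$ be a solution of the implicit scheme $$\frac{h_j(\Gamma^{m+1})-h_j(\Gamma^m)}{\tau_m}=F_j\left(\Gamma^{m+1/2},t_{m+1/2}\right)\quad(m=0,\dots,\bar m-1,\ j=1,\dots,N),\qquad \Gamma^0=\Gamma_*,$$ where $\Gamma^{m+1/2}:=\frac{\Gamma^m+\Gamma^{m+1}}{2}$ and $t_{m+1/2}:=\frac{t_m+t_{m+1}}{2}$. Let $\Omega^m$ be the bounded domain enclosed by $\Gamma^m$ and $|\Omega^m|$ its area. Then $$|\Omega^{m+1}|=|\Omega^m|+\mu\,\tau_m\qquad(m=0,1,\dots,\bar m-1).$$ In other words, $|\Omega^m|=|\Omega(t_m)|$ holds if the exact solution of the initial value problem of polygonal motion (stated in the context) exists, where $\Omega(t)$ is the bounded domain enclosed by the exact solution $\Gamma(t)$.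
   Context: Polygons. $\mathcal{P}$ is the set of polygonal Jordan curves in $\mathbb{R}^2$. An $N$-polygon $\Gamma\in\mathcal{P}$ has vertices $w_1,\dots,w_N$, numbered counterclockwise (indices mod $N$), edges $\Gamma_j=\{(1-\theta)w_{j-1}+\theta w_j;\ 0<\theta<1\}$ of length $|\Gamma_j|=|w_j-w_{j-1}|$, unit tangents $\mathbf{t}_j=(w_j-w_{j-1})/|\Gamma_j|$, outward unit normals $\mathbf{n}_j$ (with $\det(\mathbf{n}_j,\mathbf{t}_j)=1$), outer angles $\varphi_j\in(-\pi,\pi)\setminus\{0\}$ at $w_j$, and heights $h_j(\Gamma):=w_j\cdot\mathbf{n}_j$. Equivalence class. $\Gamma\sim\Sigma$ if they have the same number $N$ of edges and $\mathbf{n}_j(\Gamma)=\mathbf{n}_j(\Sigma)$ for all $j$ after a suitable counterclockwise numbering. $\mathcal{P}^*$ is the equivalence class of a fixed $N$-polygon; its members are always numbered so that their $j$th normals agree. Put $\mathbf{h}(\Gamma)=(h_1(\Gamma),\dots,h_N(\Gamma))^{\rm T}\in\mathbb{R}^N$. The metric on $\mathcal{P}^*$ is $d(\Gamma,\Sigma)=\max_j|h_j(\Gamma)-h_j(\Sigma)|$. For $\Gamma,\Sigma\in\mathcal{P}^*$, $\frac{\Gamma+\Sigma}{2}$ denotes the polygon in $\mathcal{P}^*$ (if it exists) whose height vector is $\frac{1}{2}(\mathbf{h}(\Gamma)+\mathbf{h}(\Sigma))$. Since $F$ is defined only on $\mathcal{O}$, it is part of being a solution of the scheme that $\Gamma^{m+1/2}$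 exists and belongs to $\mathcal{O}$. Polygonal motion. A $C^1$-class polygonal motion in $\mathcal{P}^*$ on an interval is a family $\Gamma(t)\in\mathcal{P}^*$ whose vertices are $C^1$ functions of $t$ (equivalently all $h_j(t)=h_j(\Gamma(t))$ are $C^1$). Its outward normal velocity is constant on each edge and equals $V_j(t)=\dot h_j(t)$. Initial value problem of polygonal motion (of which the implicit scheme is a time discretization): for a given $N$-polygon $\Gamma^*\in\mathcal{O}$, find a $C^1$-class polygonal motion $\Gamma(t)\in\mathcal{O}$ $(0\le t\le T<T_* )$ such that $V_j(t)=F_j(\Gamma(t),t)$ for $t\in[0,T]$, $j=1,\dots,N$, and $\Gamma(0)=\Gamma^*$. Local Lipschitz condition on $F$: for every compact $\mathcal{K}\subset\mathcal{O}$ and every $T'\in(0,T_* )$ there is $L(\mathcal{K},T')>0$ such that $|F(\Gamma,t)-F(\Sigma,t)|_\infty\le L(\mathcal{K},T')\,d(\Gamma,\Sigma)$ for all $\Gamma,\Sigma\in\mathcal{K}$, $t\in[0,T']$, where $|\cdot|_\infty$ is the maximum norm. *)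

theory Defs
  imports "HOL-Complex_Analysis.Complex_Analysis"
begin

text \<open>The plane is identified with \<^typ>\<open>complex\<close>, so that the library's winding number is
  available. A polygon is given by the list of its vertices; the list of an \<open>N\<close>-polygon is read
  cyclically, with indices \<open>j \<in> {1..N}\<close> (so that \<open>w\<^sub>N = w\<^sub>0\<close> is the head of the list).\<close>

definition vertex :: "complex list \<Rightarrow> nat \<Rightarrow> complex" where
  "vertex ws j = ws ! (j mod length ws)"

fun polygonal_path :: "complex list \<Rightarrow> real \<Rightarrow> complex" where
  "polygonal_path [] = linepath 0 0"
| "polygonal_path [a] = linepath a a"
| "polygonal_path [a, b] = linepath a b"
| "polygonal_path (a # b # c # ws) = linepath a b +++ polygonal_path (b # c # ws)"

definition boundary_path :: "complex list \<Rightarrow> real \<Rightarrow> complex" where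
  "boundary_path ws = polygonal_path (ws @ [hd ws])"

definition enclosed_domain :: "complex list \<Rightarrow> complex set" where
  "enclosed_domain ws = inside (path_image (boundary_path ws))"

definition area :: "complex list \<Rightarrow> real" where
  "area ws = measure lebesgue (enclosed_domain ws)"

text \<open>The \<open>j\<close>th edge joins \<open>w\<^sub>j\<^sub>-\<^sub>1\<close> to \<open>w\<^sub>j\<close>; the functions below are used for \<open>j \<ge> 1\<close> only.\<close>

definition edge_length :: "complex list \<Rightarrow> nat \<Rightarrow> real" where
  "edge_length ws j = norm (vertex ws j - vertex ws (j - 1))"

definition tangent :: "complex list \<Rightarrow> nat \<Rightarrow> complex" where
  "tangent ws j = (vertex ws j - vertex ws (j - 1)) / of_real (edge_length ws j)"

text \<open>Rotating the tangent \<open>t\<close> by a right angle clockwise gives the unit vector \<open>n\<close> with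
  \<open>det (n, t) = 1\<close>, which points outward for a counterclockwise numbering.\<close>

definition normal_vec :: "complex list \<Rightarrow> nat \<Rightarrow> complex" where
  "normal_vec ws j = - \<i> * tangent ws j"

definition outer_angle :: "complex list \<Rightarrow> nat \<Rightarrow> real" where
  "outer_angle ws j = Arg (tangent ws (j + 1) / tangent ws j)"

definition height :: "complex list \<Rightarrow> nat \<Rightarrow> real" where
  "height ws j = vertex ws j \<bullet> normal_vec ws j"

text \<open>A polygonal Jordan curve together with a counterclockwise numbering of its vertices:
  counterclockwise means that the curve winds once, positively, around the enclosed points.\<close>

definition polygon :: "complex list \<Rightarrow> bool" where
  "polygon ws \<longleftrightarrow>
     3 \<le> length ws \<and>
     simple_path (boundary_path ws) \<and>
     (\<forall>z \<in> enclosed_domain ws. winding_number (boundary_path ws) z = 1) \<and>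
     (\<forall>j \<in> {1..length ws}. outer_angle ws j \<in> {-pi<..<pi} - {0})"

text \<open>The equivalence class of a polygon, each member carrying the numbering for which its
  normals agree with those of the given polygon. (This numbering is unique: a nontrivial
  cyclic symmetry of the normals would contradict the total turning \<open>2\<pi>\<close> of a Jordan curve.)\<close>

definition polygon_class :: "complex list \<Rightarrow> complex list set" where
  "polygon_class ws\<^sub>0 =
     {ws. polygon ws \<and> length ws = length ws\<^sub>0 \<and>
          (\<forall>j \<in> {1..length ws\<^sub>0}. normal_vec ws j = normal_vec ws\<^sub>0 j)}"

text \<open>Vectors of \<open>\<real>\<^sup>N\<close> are functions evaluated on \<open>{1..N}\<close>.\<close>

definition max_norm :: "nat \<Rightarrow> (nat \<Rightarrow> real) \<Rightarrow> real" where
  "max_norm N v = Max ((\<lambda>j. \<bar>v j\<bar>) ` {1..N})"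

definition polygon_dist :: "nat \<Rightarrow> complex list \<Rightarrow> complex list \<Rightarrow> real" where
  "polygon_dist N \<Gamma> \<Sigma> = max_norm N (\<lambda>j. height \<Gamma> j - height \<Sigma> j)"

abbreviation class_topology :: "complex list \<Rightarrow> complex list topology" where
  "class_topology ws\<^sub>0 \<equiv> Metric_space.mtopology (polygon_class ws\<^sub>0) (polygon_dist (length ws\<^sub>0))"

text \<open>The interval \<open>[0, T\<^sub>*)\<close> with \<open>T\<^sub>*\<close> possibly infinite.\<close>

definition time_interval :: "ereal \<Rightarrow> real set" where
  "time_interval Ts = {t. 0 \<le> t \<and> ereal t < Ts}"

text \<open>Continuity of \<open>F : \<O> \<times> [0, T\<^sub>*) \<rightarrow> \<real>\<^sup>N\<close>, expressed componentwise.\<close>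

definition continuous_force ::
  "complex list \<Rightarrow> complex list set \<Rightarrow> ereal \<Rightarrow> (complex list \<Rightarrow> real \<Rightarrow> nat \<Rightarrow> real) \<Rightarrow> bool" where
  "continuous_force ws\<^sub>0 \<O> Ts F \<longleftrightarrow>
     (\<forall>j \<in> {1..length ws\<^sub>0}.
        continuous_map
          (prod_topology (subtopology (class_topology ws\<^sub>0) \<O>) (top_of_set (time_interval Ts)))
          euclideanreal (\<lambda>(\<Gamma>, t). F \<Gamma> t j))"

definition locally_lipschitz_force ::
  "complex list \<Rightarrow> complex list set \<Rightarrow> ereal \<Rightarrow> (complex list \<Rightarrow> real \<Rightarrow> nat \<Rightarrow> real) \<Rightarrow> bool" where
  "locally_lipschitz_force ws\<^sub>0 \<O> Ts F \<longleftrightarrow>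
     (\<forall>K T'. compactin (class_topology ws\<^sub>0) K \<and> K \<subseteq> \<O> \<and> 0 < T' \<and> ereal T' < Ts \<longrightarrow>
        (\<exists>L>0. \<forall>\<Gamma>\<in>K. \<forall>\<Sigma>\<in>K. \<forall>t\<in>{0..T'}.
           max_norm (length ws\<^sub>0) (\<lambda>j. F \<Gamma> t j - F \<Sigma> t j) \<le> L * polygon_dist (length ws\<^sub>0) \<Gamma> \<Sigma>))"

definition is_midpoint ::
  "complex list \<Rightarrow> complex list \<Rightarrow> complex list \<Rightarrow> complex list \<Rightarrow> bool" where
  "is_midpoint ws\<^sub>0 \<Gamma> \<Sigma> M \<longleftrightarrow>
     M \<in> polygon_class ws\<^sub>0 \<and>
     (\<forall>j \<in> {1..length ws\<^sub>0}. height M j = (height \<Gamma> j + height \<Sigma> j) / 2)"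

definition scheme_solution ::
  "complex list \<Rightarrow> complex list set \<Rightarrow> (complex list \<Rightarrow> real \<Rightarrow> nat \<Rightarrow> real) \<Rightarrow>
   (nat \<Rightarrow> real) \<Rightarrow> nat \<Rightarrow> complex list \<Rightarrow> (nat \<Rightarrow> complex list) \<Rightarrow> bool" where
  "scheme_solution ws\<^sub>0 \<O> F t mbar \<Gamma>\<^sub>0 \<Gamma> \<longleftrightarrow>
     \<Gamma> 0 = \<Gamma>\<^sub>0 \<and> (\<forall>m \<in> {1..mbar}. \<Gamma> m \<in> \<O>) \<and>
     (\<forall>m < mbar. \<exists>M \<in> \<O>. is_midpoint ws\<^sub>0 (\<Gamma> m) (\<Gamma> (Suc m)) M \<and>
        (\<forall>j \<in> {1..length ws\<^sub>0}.
           (height (\<Gamma> (Suc m)) j - height (\<Gamma> m) j) / (t (Suc m) - t m) =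
           F M ((t m + t (Suc m)) / 2) j))"

text \<open>Derivatives at the end points of \<open>[0, T]\<close> are one-sided.\<close>

definition C1_polygonal_motion ::
  "complex list \<Rightarrow> real \<Rightarrow> (real \<Rightarrow> complex list) \<Rightarrow> bool" where
  "C1_polygonal_motion ws\<^sub>0 T \<Gamma> \<longleftrightarrow>
     (\<forall>t \<in> {0..T}. \<Gamma> t \<in> polygon_class ws\<^sub>0) \<and>
     (\<forall>j \<in> {1..length ws\<^sub>0}. \<exists>w'. continuous_on {0..T} w' \<and>
        (\<forall>t \<in> {0..T}. ((\<lambda>s. vertex (\<Gamma> s) j) has_vector_derivative w' t) (at t within {0..T})))"

definition normal_velocity :: "real \<Rightarrow> (real \<Rightarrow> complex list) \<Rightarrow> real \<Rightarrow> nat \<Rightarrow> real" where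
  "normal_velocity T \<Gamma> t j = vector_derivative (\<lambda>s. height (\<Gamma> s) j) (at t within {0..T})"

definition exact_solution ::
  "complex list \<Rightarrow> complex list set \<Rightarrow> (complex list \<Rightarrow> real \<Rightarrow> nat \<Rightarrow> real) \<Rightarrow>
   real \<Rightarrow> complex list \<Rightarrow> (real \<Rightarrow> complex list) \<Rightarrow> bool" where
  "exact_solution ws\<^sub>0 \<O> F T \<Gamma>\<^sub>0 \<Gamma> \<longleftrightarrow>
     C1_polygonal_motion ws\<^sub>0 T \<Gamma> \<and> (\<forall>t \<in> {0..T}. \<Gamma> t \<in> \<O>) \<and>
     (\<forall>t \<in> {0..T}. \<forall>j \<in> {1..length ws\<^sub>0}. normal_velocity T \<Gamma> t j = F (\<Gamma> t) t j) \<and>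
     \<Gamma> 0 = \<Gamma>\<^sub>0"

text \<open>The height distance is a metric on the class, so \<open>class_topology\<close> is its metric topology.\<close>

lemma max_norm_ge: "j \<in> {1..N} \<Longrightarrow> \<bar>v j\<bar> \<le> max_norm N v"
  unfolding max_norm_def by (intro Max_ge) auto

lemma max_norm_le:
  assumes "1 \<le> N" "\<And>j. j \<in> {1..N} \<Longrightarrow> \<bar>v j\<bar> \<le> c"
  shows "max_norm N v \<le> c"
  unfolding max_norm_def using assms by (subst Max_le_iff) auto

lemma inner_normal_step:
  "vertex ws j \<bullet> normal_vec ws (Suc j) = height ws (Suc j)"
proof -
  have "(vertex ws (Suc j) - vertex ws j) \<bullet> normal_vec ws (Suc j) = 0"
    unfolding normal_vec_def tangent_def
    by (simp add: inner_complex_def Re_divide_of_real Im_divide_of_real algebra_simps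
        flip: add_divide_distrib diff_divide_distrib)
  then show ?thesis by (simp add: height_def inner_diff_left)
qed

lemma inner_two_normals_zero:
  fixes z t u :: complex
  assumes "z \<bullet> (- \<i> * t) = 0" "z \<bullet> (- \<i> * u) = 0" "Arg (u / t) \<in> {-pi<..<pi} - {0}"
  shows "z = 0"
proof (rule ccontr)
  assume z: "z \<noteq> 0"
  have t: "t \<noteq> 0" using assms(3) by (auto simp: Arg_zero)
  have e: "Re z * Im t = Im z * Re t" "Re z * Im u = Im z * Re u"
    using assms(1,2) by (auto simp: inner_complex_def)
  have "Im u * Re t = Re u * Im t"
  proof (cases "Re z = 0")
    case True
    then have "Im z \<noteq> 0" using z by (simp add: complex_eq_iff)
    then show ?thesis using e True by simp
  next
    case False
    have "Re z * (Im u * Re t) = Re z * (Re u * Im t)" using e by algebra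
    then show ?thesis using False by simp
  qed
  then have "Im (u / t) = 0" by (simp add: Im_divide)
  then obtain r where r: "u / t = complex_of_real r"
    by (metis complex_is_Real_iff Reals_cases)
  have "Arg (u / t) = 0 \<or> Arg (u / t) = pi"
    unfolding r by (simp add: Arg_of_real)
  then show False using assms(3) by auto
qed

lemma Metric_space_polygon_class:
  assumes "polygon ws\<^sub>0"
  shows "Metric_space (polygon_class ws\<^sub>0) (polygon_dist (length ws\<^sub>0))"
proof
  fix x y z
  assume xyz: "x \<in> polygon_class ws\<^sub>0" "y \<in> polygon_class ws\<^sub>0"
  define N where "N = length ws\<^sub>0"
  have len: "length x = N" "length y = N" "3 \<le> N" and px: "polygon x"
    using xyz by (auto simp: polygon_class_def N_def polygon_def)
  have nrm: "normal_vec x j = normal_vec y j" if "j \<in> {1..N}" for j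
    using xyz that by (auto simp: polygon_class_def N_def)
  show "(polygon_dist (length ws\<^sub>0) x y = 0) = (x = y)"
  proof
    assume "x = y"
    then show "polygon_dist (length ws\<^sub>0) x y = 0"
      using len by (simp add: polygon_dist_def max_norm_def N_def[symmetric])
  next
    assume 0: "polygon_dist (length ws\<^sub>0) x y = 0"
    have h: "height x j = height y j" if "j \<in> {1..N}" for j
      using max_norm_ge[of j N "\<lambda>j. height x j - height y j"] 0 that len
      by (simp add: polygon_dist_def N_def[symmetric])
    have cyc: "vertex x (Suc N) = vertex x 1" "vertex y (Suc N) = vertex y 1"
      "vertex x N = vertex x 0" "vertex y N = vertex y 0"
      using len by (auto simp: vertex_def mod_Suc)
    have nS: "normal_vec x (Suc N) = normal_vec x 1" "normal_vec y (Suc N) = normal_vec y 1"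
      using cyc by (auto simp: normal_vec_def tangent_def edge_length_def)
    have hS: "height x (Suc N) = height x 1" "height y (Suc N) = height y 1"
      using cyc nS by (auto simp: height_def)
    have "vertex x j = vertex y j" if j: "j \<in> {1..N}" for j
    proof -
      have a: "(vertex x j - vertex y j) \<bullet> normal_vec x j = 0"
        using h[OF j] nrm[OF j] by (simp add: height_def inner_diff_left)
      have "height x (Suc j) = height y (Suc j)" "normal_vec x (Suc j) = normal_vec y (Suc j)"
        using h[of 1] h[of "Suc j"] nrm[of 1] nrm[of "Suc j"] hS nS j len
        by (cases "j = N"; force)+
      then have b: "(vertex x j - vertex y j) \<bullet> normal_vec x (Suc j) = 0"
        using inner_normal_step[of x j] inner_normal_step[of y j] by (simp add: inner_diff_left)
      have "outer_angle x j \<in> {-pi<..<pi} - {0}"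
        using px j len by (auto simp: polygon_def)
      then have "vertex x j - vertex y j = 0"
        using inner_two_normals_zero a b
        unfolding normal_vec_def outer_angle_def by (metis Suc_eq_plus1)
      then show ?thesis by simp
    qed
    note v = this
    show "x = y"
    proof (rule nth_equalityI)
      show "length x = length y" using len by simp
      fix i assume "i < length x"
      then show "x ! i = y ! i"
        using v[of i] v[of N] len cyc by (cases "i = 0") (auto simp: vertex_def)
    qed
  qed
  assume z: "z \<in> polygon_class ws\<^sub>0"
  show "polygon_dist (length ws\<^sub>0) x z \<le> polygon_dist (length ws\<^sub>0) x y + polygon_dist (length ws\<^sub>0) y z"
    unfolding polygon_dist_def N_def[symmetric]
  proof (rule max_norm_le)
    fix j assume j: "j \<in> {1..N}"
    show "\<bar>height x j - height z j\<bar> \<le> max_norm N (\<lambda>j. height x j - height y j) +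
        max_norm N (\<lambda>j. height y j - height z j)"
      using max_norm_ge[OF j, of "\<lambda>j. height x j - height y j"]
        max_norm_ge[OF j, of "\<lambda>j. height y j - height z j"] by linarith
  qed (use len in simp)
next
  fix x y :: "complex list"
  have "1 \<in> {1..length ws\<^sub>0}" using assms by (auto simp: polygon_def)
  from max_norm_ge[OF this, of "\<lambda>j. height x j - height y j"]
  show "0 \<le> polygon_dist (length ws\<^sub>0) x y" unfolding polygon_dist_def by linarith
  show "polygon_dist (length ws\<^sub>0) x y = polygon_dist (length ws\<^sub>0) y x"
    by (simp add: polygon_dist_def max_norm_def abs_minus_commute)
qed

end

theory Submission
  imports Defs
begin

text \<open>
  The sum \<open>\<Sum>\<^sub>j |\<Gamma>\<^sub>j| V\<^sub>j\<close> is the first variation of area: moving every edge with normal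
  velocity \<open>V\<^sub>j\<close> changes the enclosed area at that rate. With \<open>V\<^sub>j = F\<^sub>j\<close> the hypothesis on
  \<open>F\<close> says that the area of an exact solution grows at the constant rate \<open>\<mu>\<close>. For the scheme
  there is no error because, inside an equivalence class, the area is a \<^emph>\<open>quadratic\<close>
  function of the heights, and a difference of values of a quadratic function equals the derivative at
  the midpoint applied to the difference of the arguments. The derivative at the midpoint is
  given by the edge lengths of the midpoint polygon, and these are exactly the weights that the
  scheme, evaluated at the midpoint, combines to \<open>\<mu>\<close> times the time step.

  That the area is quadratic is the shoelace formula (\<open>area_eq_shoelace\<close>), and its proof is the
  main work. It avoids triangulating the polygon. A closed polygonal path winds around a
  point as often as the triangles \<open>0, w\<^sub>j\<^sub>-\<^sub>1, w\<^sub>j\<close> do together, because the sides through \<open>0\<close>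
  cancel; each triangle contributes the sign of its orientation inside and nothing outside.
  Since the polygon winds once around the points that it encloses and not at all around the others,
  the indicator of the enclosed domain is almost everywhere a signed sum of indicators
  of triangles. Integrating gives a signed sum of triangle areas, which is the shoelace sum.

  The first variation is computed in vertex coordinates (\<open>sum_edge_length_velocity\<close>) and used
  twice: for finite differences in \<open>area_midpoint_rule\<close> and for time derivatives in
  \<open>area_has_derivative_of_motion\<close>.
\<close>

section \<open>The area of a triangle in the complex plane\<close>

definition cross2 :: "complex \<Rightarrow> complex \<Rightarrow> real" where
  "cross2 a b = Re a * Im b - Im a * Re b"

text \<open>Both measures give a box the product of its side lengths, which determines them. This
  carries area formulas for \<^typ>\<open>real^2\<close> over to \<^typ>\<open>complex\<close>.\<close>

lemma lborel_complex_eq_distr: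
  "(lborel :: complex measure) = distr (lborel :: (real^2) measure) borel (\<lambda>x. Complex (vec_nth x 1) (vec_nth x 2))"
proof (rule lborel_eqI)
  have cont: "continuous_on UNIV (\<lambda>x::real^2. Complex (vec_nth x 1) (vec_nth x 2))"
    by (simp add: Complex_eq continuous_intros)
  then have meas: "(\<lambda>x::real^2. Complex (vec_nth x 1) (vec_nth x 2)) \<in> borel_measurable borel"
    by (rule borel_measurable_continuous_onI)
  fix l u :: complex
  assume lu: "\<And>b. b \<in> Basis \<Longrightarrow> l \<bullet> b \<le> u \<bullet> b"
  define l' :: "real^2" where "l' = vector [Re l, Im l]"
  define u' :: "real^2" where "u' = vector [Re u, Im u]"
  have comp: "vec_nth l' 1 = Re l" "vec_nth l' 2 = Im l" "vec_nth u' 1 = Re u" "vec_nth u' 2 = Im u"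
    by (simp_all add: l'_def u'_def)
  have vim: "(\<lambda>x::real^2. Complex (vec_nth x 1) (vec_nth x 2)) -` box l u = box l' u'"
    by (auto simp: box_def Basis_complex_def Basis_vec_def inner_axis comp forall_2 inner_complex_def)
  have le: "Re l \<le> Re u" "Im l \<le> Im u"
    using lu[of 1] lu[of \<i>] by (auto simp: Basis_complex_def inner_complex_def)
  have *: "(Basis :: (real^2) set) = {axis 1 1, axis 2 1}" and ne: "axis 1 1 \<noteq> (axis 2 1 :: real^2)"
    by (auto simp: Basis_vec_def exhaust_2 UNIV_2 axis_eq_axis)
  have "emeasure lborel (box l' u') = (\<Prod>b\<in>Basis. (u' - l') \<bullet> b)"
    by (rule emeasure_lborel_box) (use le in \<open>auto simp: * inner_axis comp\<close>)
  also have "(\<Prod>b\<in>Basis. (u' - l') \<bullet> b) = (\<Prod>b\<in>Basis. (u - l) \<bullet> b)"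
    using ne by (simp add: * inner_axis comp Basis_complex_def inner_complex_def)
  finally show "emeasure (distr lborel borel (\<lambda>x::real^2. Complex (vec_nth x 1) (vec_nth x 2))) (box l u) =
      (\<Prod>b\<in>Basis. (u - l) \<bullet> b)"
    using meas by (simp add: emeasure_distr vim)
qed simp

lemma measure_triangle_complex:
  "measure lebesgue (convex hull {0, a, b}) = \<bar>cross2 a b\<bar> / 2"
proof -
  let ?f = "\<lambda>x::real^2. Complex (vec_nth x 1) (vec_nth x 2)"
  define a' b' :: "real^2" where "a' = vector [Re a, Im a]" and "b' = vector [Re b, Im b]"
  have lin: "linear ?f"
    by (auto simp: linear_iff complex_eq_iff)
  have inj: "inj ?f"
    by (auto simp: inj_def vec_eq_iff forall_2)
  have img: "?f ` (convex hull {0, a', b'}) = convex hull {0, a, b}"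
    using lin by (simp add: convex_hull_linear_image a'_def b'_def flip: zero_complex.code)
  have vim: "?f -` (convex hull {0, a, b}) = convex hull {0, a', b'}"
    unfolding img[symmetric] by (rule inj_vimage_image_eq[OF inj])
  have closed: "closed (convex hull {0, a, b})"
    by (intro compact_imp_closed compact_convex_hull) auto
  then have borel: "convex hull {0, a, b} \<in> sets borel" by simp
  have meas: "?f \<in> borel_measurable borel"
    by (intro borel_measurable_continuous_onI) (simp add: Complex_eq continuous_intros)
  have "measure lebesgue (convex hull {0, a, b}) = measure lborel (convex hull {0, a, b})"
    using borel by (simp add: measure_completion)
  also have "\<dots> = measure lborel (convex hull {0, a', b'})"
    using borel meas by (subst lborel_complex_eq_distr) (simp add: measure_distr vim)
  also have "\<dots> = \<bar>cross2 a b\<bar> / 2"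
    unfolding content_triangle by (simp add: a'_def b'_def cross2_def abs_if algebra_simps)
  finally show ?thesis .
qed

section \<open>Winding numbers of closed polygonal paths\<close>

lemma polygonal_path_props:
  assumes "2 \<le> length ws"
  shows "path (polygonal_path ws) \<and> pathstart (polygonal_path ws) = hd ws \<and>
         pathfinish (polygonal_path ws) = last ws \<and>
         path_image (polygonal_path ws) = (\<Union>i<length ws - 1. closed_segment (ws ! i) (ws ! Suc i))"
  using assms
proof (induction ws rule: polygonal_path.induct)
  case (4 a b c ws)
  have "{..<length (a # b # c # ws) - 1} = insert 0 (Suc ` {..<length (b # c # ws) - 1})"
    by (auto simp: lessThan_Suc_eq_insert_0)
  then show ?case using 4 by (simp add: path_image_join)
qed auto

lemma winding_number_polygonal_path:
  assumes "2 \<le> length ws" "z \<notin> path_image (polygonal_path ws)"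
  shows "winding_number (polygonal_path ws) z =
           (\<Sum>i<length ws - 1. winding_number (linepath (ws ! i) (ws ! Suc i)) z)"
  using assms
proof (induction ws rule: polygonal_path.induct)
  case (4 a b c ws)
  have P: "path (polygonal_path (b # c # ws))" "pathstart (polygonal_path (b # c # ws)) = b"
    using polygonal_path_props[of "b # c # ws"] by auto
  then have z: "z \<notin> closed_segment a b" "z \<notin> path_image (polygonal_path (b # c # ws))"
    using 4(3) by (auto simp: path_image_join)
  have "winding_number (polygonal_path (a # b # c # ws)) z =
      winding_number (linepath a b) z + winding_number (polygonal_path (b # c # ws)) z"
    using P z by (simp add: winding_number_join)
  also have "\<dots> = winding_number (linepath a b) z +
      (\<Sum>i<length (b # c # ws) - 1. winding_number (linepath ((b # c # ws) ! i) ((b # c # ws) ! Suc i)) z)"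
    using 4(1) z by simp
  also have "\<dots> = (\<Sum>i<length (a # b # c # ws) - 1.
      winding_number (linepath ((a # b # c # ws) ! i) ((a # b # c # ws) ! Suc i)) z)"
    by (simp add: sum.lessThan_Suc_shift del: sum.lessThan_Suc)
  finally show ?case .
qed auto

text \<open>Off its frontier a triangle \<open>0, a, b\<close> is wound around by its boundary according to its
  orientation. The degenerate case is included: a flat triangle has no interior points, and the sign
  vanishes. The exclusion of the sides is part of the conclusion, because only then can the winding
  numbers of the three sides be treated separately.\<close>

lemma winding_number_triangle_origin:
  assumes "z \<notin> frontier (convex hull {0, a, b})"
  shows "z \<notin> closed_segment 0 a" "z \<notin> closed_segment a b" "z \<notin> closed_segment b 0"
    and "winding_number (linepath 0 a) z + winding_number (linepath a b) z
           + winding_number (linepath b 0) z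
         = of_real (sgn (cross2 a b) * indicator (convex hull {0, a, b}) z)"
proof -
  let ?T = "convex hull {0, a, b}"
  have cl: "closed ?T"
    by (intro compact_imp_closed compact_convex_hull) auto
  have zz: "z \<in> interior ?T \<or> z \<notin> ?T"
    using assms cl by (auto simp: frontier_def)
  have segs: "closed_segment 0 a \<subseteq> ?T" "closed_segment a b \<subseteq> ?T" "closed_segment b 0 \<subseteq> ?T"
    by (simp_all add: segment_convex_hull hull_mono)
  have disj: "interior ?T \<inter> (closed_segment 0 a \<union> closed_segment a b \<union> closed_segment b 0) = {}"
    using interior_of_triangle[of 0 a b] by auto
  show n: "z \<notin> closed_segment 0 a" "z \<notin> closed_segment a b" "z \<notin> closed_segment b 0"
    using zz segs disj by blast+
  have sum: "winding_number (linepath 0 a) z + winding_number (linepath a b) z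
           + winding_number (linepath b 0) z = winding_number (linepath 0 a +++ linepath a b +++ linepath b 0) z"
    using n by (simp add: winding_number_join not_in_path_image_join)
  show "winding_number (linepath 0 a) z + winding_number (linepath a b) z
           + winding_number (linepath b 0) z
         = of_real (sgn (cross2 a b) * indicator ?T z)"
  proof (cases "z \<in> ?T")
    case False
    have "winding_number (linepath 0 a +++ linepath a b +++ linepath b 0) z = 0"
      by (rule winding_number_zero_outside[where s = "?T"])
         (use False segs in \<open>auto simp: path_image_join\<close>)
    then show ?thesis using False sum by simp
  next
    case True
    then have int: "z \<in> interior ?T" using zz by simp
    \<comment> \<open>An interior point lies strictly on the same side of all three edges; the three quantities
      that measure this add up to \<open>cross2 a b\<close>, so they share its sign.\<close>
    have "(if 0 < Im ((a - 0) * cnj (a - z)) then 1 else - 1) = sgn (cross2 a b)"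
      using wn_triangle2[OF int]
      by (auto simp: cross2_def sgn_if algebra_simps)
    then have "winding_number (linepath 0 a +++ linepath a b +++ linepath b 0) z
        = of_real (sgn (cross2 a b))"
      unfolding winding_number_triangle[OF int] by (metis of_real_1 of_real_minus)
    then show ?thesis using True sum by simp
  qed
qed

lemma vertex_closed_list:
  assumes "ws \<noteq> []" "i \<le> length ws"
  shows "(ws @ [hd ws]) ! i = vertex ws i"
  using assms by (auto simp: vertex_def nth_append hd_conv_nth)

lemma vertex_length: "length ws = N \<Longrightarrow> vertex ws N = vertex ws 0"
  by (simp add: vertex_def)

lemma boundary_path_props:
  assumes "ws \<noteq> []"
  shows "path (boundary_path ws)" "pathfinish (boundary_path ws) = pathstart (boundary_path ws)"
    "path_image (boundary_path ws) =
       (\<Union>i<length ws. closed_segment (vertex ws i) (vertex ws (Suc i)))"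
  using polygonal_path_props[of "ws @ [hd ws]"] assms
  by (auto simp: boundary_path_def vertex_closed_list Suc_le_eq less_imp_le simp del: nth_append_length
       intro: less_imp_le)

text \<open>Closing each edge to a triangle with apex \<open>0\<close> adds the spokes from \<open>0\<close> to its two end
  points, with opposite signs. Around the closed path every spoke occurs once with each sign, so that
  the total is unchanged.\<close>

lemma winding_number_boundary_path:
  assumes ws: "ws \<noteq> []"
    and z: "\<And>i. i < length ws \<Longrightarrow> z \<notin> frontier (convex hull {0, vertex ws i, vertex ws (Suc i)})"
  shows "winding_number (boundary_path ws) z =
    of_real (\<Sum>i<length ws. sgn (cross2 (vertex ws i) (vertex ws (Suc i))) *
       indicator (convex hull {0, vertex ws i, vertex ws (Suc i)}) z)"
proof -
  let ?v = "vertex ws"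
  let ?W = "\<lambda>i. winding_number (linepath 0 (?v i)) z"
  note tri = winding_number_triangle_origin[OF z]
  have "z \<notin> path_image (boundary_path ws)"
    using tri(2) boundary_path_props(3)[OF ws] by auto
  then have "winding_number (boundary_path ws) z =
      (\<Sum>i<length ws. winding_number (linepath (?v i) (?v (Suc i))) z)"
    using winding_number_polygonal_path[of "ws @ [hd ws]" z] ws
    by (simp add: boundary_path_def vertex_closed_list Suc_le_eq)
  also have "\<dots> = (\<Sum>i<length ws. of_real (sgn (cross2 (?v i) (?v (Suc i))) *
       indicator (convex hull {0, ?v i, ?v (Suc i)}) z) - (?W i - ?W (Suc i)))"
  proof (rule sum.cong[OF refl])
    fix i assume "i \<in> {..<length ws}"
    then have i: "i < length ws" by simp
    have "winding_number (linepath (?v (Suc i)) 0) z = - ?W (Suc i)"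
      using winding_number_reversepath[of "linepath (?v (Suc i)) 0" z] tri(3)[OF i] by simp
    then show "winding_number (linepath (?v i) (?v (Suc i))) z =
        of_real (sgn (cross2 (?v i) (?v (Suc i))) *
          indicator (convex hull {0, ?v i, ?v (Suc i)}) z) - (?W i - ?W (Suc i))"
      using tri(4)[OF i] by (simp add: algebra_simps)
  qed
  also have "\<dots> = of_real (\<Sum>i<length ws. sgn (cross2 (?v i) (?v (Suc i))) *
       indicator (convex hull {0, ?v i, ?v (Suc i)}) z) - (\<Sum>i<length ws. ?W i - ?W (Suc i))"
    unfolding of_real_sum by (rule sum_subtractf)
  also have "(\<Sum>i<length ws. ?W i - ?W (Suc i)) = 0"
    unfolding sum_lessThan_telescope'[of ?W] by (simp add: vertex_length)
  finally show ?thesis by simp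
qed

section \<open>The shoelace formula\<close>

definition shoelace :: "complex list \<Rightarrow> real" where
  "shoelace ws = (\<Sum>j = 1..length ws. cross2 (vertex ws (j - 1)) (vertex ws j)) / 2"

lemma shoelace_altdef:
  "shoelace ws = (\<Sum>i<length ws. cross2 (vertex ws i) (vertex ws (Suc i))) / 2"
  by (simp add: shoelace_def sum.atLeast1_atMost_eq)

text \<open>The area is the integral of the winding number, since that number is the indicator of the
  enclosed domain away from the curve. Expanding it by triangles leaves an exceptional set
  consisting of finitely many frontiers of convex sets, which is negligible and contains the curve.\<close>

theorem area_eq_shoelace:
  assumes "polygon ws"
  shows "area ws = shoelace ws"
proof -
  let ?v = "vertex ws"
  define T where "T i = convex hull {0, ?v i, ?v (Suc i)}" for i
  define c where "c i = cross2 (?v i) (?v (Suc i))" for i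
  let ?D = "enclosed_domain ws"
  have ws: "ws \<noteq> []" using assms by (auto simp: polygon_def)
  note bp = boundary_path_props[OF ws]
  have T: "T i \<in> lmeasurable" "measure lebesgue (T i) = \<bar>c i\<bar> / 2" for i
    unfolding T_def c_def measure_triangle_complex
    by (auto intro!: lmeasurable_compact compact_convex_hull)
  have D: "?D \<in> lmeasurable"
    unfolding enclosed_domain_def
    by (intro lmeasurable_open open_inside bounded_inside closed_path_image bounded_path_image bp)
  define E where "E = (\<Union>i<length ws. frontier (T i))"
  have E: "negligible E"
    unfolding E_def T_def by (auto intro!: negligible_Union negligible_convex_frontier)
  have eq: "indicat_real ?D z = (\<Sum>i<length ws. sgn (c i) * indicator (T i) z)" if "z \<notin> E" for z
  proof -
    have fr: "z \<notin> frontier (convex hull {0, ?v i, ?v (Suc i)})" if "i < length ws" for i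
      using \<open>z \<notin> E\<close> that by (auto simp: E_def T_def)
    have w: "winding_number (boundary_path ws) z = of_real (\<Sum>i<length ws. sgn (c i) * indicator (T i) z)"
      using winding_number_boundary_path[OF ws fr] by (simp add: c_def T_def)
    have "z \<notin> path_image (boundary_path ws)"
      using winding_number_triangle_origin(2)[OF fr] bp(3) by auto
    then have "z \<in> ?D \<or> z \<in> outside (path_image (boundary_path ws))"
      by (auto simp: enclosed_domain_def inside_outside)
    moreover have "winding_number (boundary_path ws) z = 1" if "z \<in> ?D"
      using assms that by (auto simp: polygon_def)
    moreover have "winding_number (boundary_path ws) z = 0" "z \<notin> ?D"
      if "z \<in> outside (path_image (boundary_path ws))"
      using winding_number_zero_in_outside[OF bp(1,2) that] that
      by (auto simp: enclosed_domain_def inside_outside)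
    ultimately have "winding_number (boundary_path ws) z = of_real (indicat_real ?D z)"
      by auto
    then show ?thesis using w by (metis of_real_eq_iff)
  qed
  have AE: "AE z in lebesgue. (\<Sum>i<length ws. sgn (c i) * indicator (T i) z) = indicat_real ?D z"
  proof (rule AE_I')
    show "E \<in> null_sets lebesgue" using E by (simp add: negligible_iff_null_sets)
  qed (use eq[symmetric] in blast)
  have "area ws = (\<integral>z. indicat_real ?D z \<partial>lebesgue)"
    using D by (simp add: area_def)
  also have "\<dots> = (\<integral>z. (\<Sum>i<length ws. sgn (c i) * indicat_real (T i) z) \<partial>lebesgue)"
  proof (rule integral_cong_AE)
    show "(\<lambda>z. \<Sum>i<length ws. sgn (c i) * indicat_real (T i) z) \<in> borel_measurable lebesgue"
      using T(1) by (intro borel_measurable_sum borel_measurable_times borel_measurable_indicator) auto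
    show "indicat_real ?D \<in> borel_measurable lebesgue"
      using D by (intro borel_measurable_indicator) auto
  qed (use AE in \<open>auto elim: AE_mp\<close>)
  also have "\<dots> = (\<Sum>i<length ws. sgn (c i) * measure lebesgue (T i))"
  proof (subst Bochner_Integration.integral_sum)
    show "integrable lebesgue (\<lambda>z. sgn (c i) * indicat_real (T i) z)" for i
    proof (intro integrable_mult_right integrable_real_indicator)
      show "T i \<in> sets lebesgue" "emeasure lebesgue (T i) < \<infinity>"
        using T(1)[of i] unfolding fmeasurable_def by blast+
    qed
  qed (use T(1) in simp)
  also have "\<dots> = shoelace ws"
    by (simp add: T(2) shoelace_altdef c_def sum_divide_distrib mult_sgn_abs)
  finally show ?thesis .
qed

section \<open>The first variation of area\<close>

text \<open>The length factor removes the normalisation of the tangent. The identity also holds for an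
  edge of length \<open>0\<close>, where both sides vanish.\<close>

lemma edge_length_normal: "of_real (edge_length M j) * normal_vec M j = - \<i> * (vertex M j - vertex M (j - 1))"
  by (simp add: normal_vec_def tangent_def edge_length_def)

lemma edge_length_inner_normal:
  "edge_length M j * (v \<bullet> normal_vec M j) = cross2 v (vertex M j - vertex M (j - 1))"
proof -
  have "edge_length M j * (v \<bullet> normal_vec M j) = v \<bullet> (of_real (edge_length M j) * normal_vec M j)"
    by (simp flip: scaleR_conv_of_real)
  then show ?thesis unfolding edge_length_normal by (simp add: inner_complex_def cross2_def algebra_simps)
qed

text \<open>Here \<open>d\<close> is a displacement (or velocity) of the vertices that moves both ends of the \<open>j\<close>th
  edge by the same amount \<open>V j\<close> in the normal direction. The right-hand side is the derivative of the
  shoelace sum in the direction \<open>d\<close>. Averaging the contributions of the two ends of an edge makes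
  the sums agree up to a telescoping term, which vanishes because the polygon is closed.\<close>

lemma sum_edge_length_velocity:
  assumes N: "length M = N" and d: "d N = d 0"
    and V: "\<And>j. j \<in> {1..N} \<Longrightarrow> d j \<bullet> normal_vec M j = V j"
           "\<And>j. j \<in> {1..N} \<Longrightarrow> d (j - 1) \<bullet> normal_vec M j = V j"
  shows "(\<Sum>j = 1..N. edge_length M j * V j) =
    (\<Sum>j = 1..N. cross2 (d (j - 1)) (vertex M j) + cross2 (vertex M (j - 1)) (d j)) / 2"
proof -
  let ?m = "vertex M"
  have "(\<Sum>j = 1..N. edge_length M j * V j) =
      (\<Sum>j = 1..N. (cross2 (d j) (?m j - ?m (j - 1)) + cross2 (d (j - 1)) (?m j - ?m (j - 1))) / 2)"
  proof (rule sum.cong[OF refl])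
    fix j assume j: "j \<in> {1..N}"
    show "edge_length M j * V j =
        (cross2 (d j) (?m j - ?m (j - 1)) + cross2 (d (j - 1)) (?m j - ?m (j - 1))) / 2"
      using edge_length_inner_normal[of M j "d j"] edge_length_inner_normal[of M j "d (j - 1)"]
        V[OF j] by simp
  qed
  also have "\<dots> = (\<Sum>j = 1..N. (cross2 (d (j - 1)) (?m j) + cross2 (?m (j - 1)) (d j)) / 2
      + (cross2 (d j) (?m j) - cross2 (d (j - 1)) (?m (j - 1))) / 2)"
    by (intro sum.cong) (auto simp: cross2_def field_simps)
  also have "\<dots> = (\<Sum>j = 1..N. cross2 (d (j - 1)) (?m j) + cross2 (?m (j - 1)) (d j)) / 2
      + (\<Sum>j = 1..N. cross2 (d j) (?m j) - cross2 (d (j - 1)) (?m (j - 1))) / 2"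
    unfolding sum_divide_distrib by (rule sum.distrib)
  also have "(\<Sum>j = 1..N. cross2 (d j) (?m j) - cross2 (d (j - 1)) (?m (j - 1))) = 0"
    using sum_telescope''[of 0 N "\<lambda>j. cross2 (d j) (?m j)"] d vertex_length[OF N]
    by (simp flip: One_nat_def)
  finally show ?thesis by simp
qed


section \<open>Vertices and heights\<close>

lemma inner_normal_previous_vertex:
  assumes "1 \<le> j"
  shows "vertex ws (j - 1) \<bullet> normal_vec ws j = height ws j"
  using inner_normal_step[of ws "j - 1"] assms by simp

lemma normal_vec_Suc_length:
  "length ws = N \<Longrightarrow> 0 < N \<Longrightarrow> normal_vec ws (Suc N) = normal_vec ws 1"
  by (auto simp: normal_vec_def tangent_def edge_length_def vertex_def mod_Suc)

text \<open>A vertex is the intersection of the lines through its two adjacent edges, which are not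
  parallel because the outer angle is neither \<open>0\<close> nor \<open>\<pi>\<close>.\<close>

lemma vertex_eqI:
  assumes "polygon ws" and j: "j \<in> {1..length ws}"
    and "v \<bullet> normal_vec ws j = height ws j" "v \<bullet> normal_vec ws (Suc j) = height ws (Suc j)"
  shows "v = vertex ws j"
proof -
  have "(v - vertex ws j) \<bullet> normal_vec ws j = 0" "(v - vertex ws j) \<bullet> normal_vec ws (Suc j) = 0"
    using assms(3,4) inner_normal_step[of ws j] by (simp_all add: inner_diff_left height_def)
  moreover have "outer_angle ws j \<in> {-pi<..<pi} - {0}"
    using assms(1) j by (auto simp: polygon_def)
  ultimately have "v - vertex ws j = 0"
    unfolding normal_vec_def outer_angle_def by (metis inner_two_normals_zero Suc_eq_plus1)
  then show ?thesis by simp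
qed

text \<open>For fixed normals the heights determine the vertices by linear equations. Hence averaging the
  heights of two polygons averages their vertices.\<close>

lemma vertex_midpoint:
  assumes "\<Gamma> \<in> polygon_class P" "\<Sigma> \<in> polygon_class P" "is_midpoint P \<Gamma> \<Sigma> M"
    and j: "j \<le> length P"
  shows "vertex M j = (vertex \<Gamma> j + vertex \<Sigma> j) / 2"
proof -
  define N where "N = length P"
  have len: "length M = N" "length \<Gamma> = N" "length \<Sigma> = N" "0 < N" and M: "polygon M"
    and n: "\<And>i. i \<in> {1..N} \<Longrightarrow> normal_vec \<Gamma> i = normal_vec M i \<and> normal_vec \<Sigma> i = normal_vec M i"
    and h: "\<And>i. i \<in> {1..N} \<Longrightarrow> height M i = (height \<Gamma> i + height \<Sigma> i) / 2"
    using assms(1-3) by (auto simp: polygon_class_def is_midpoint_def N_def polygon_def)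
  have pos: "vertex M i = (vertex \<Gamma> i + vertex \<Sigma> i) / 2" if i: "i \<in> {1..N}" for i
  proof -
    let ?v = "(vertex \<Gamma> i + vertex \<Sigma> i) / 2"
    have half: "?v \<bullet> u = (vertex \<Gamma> i \<bullet> u + vertex \<Sigma> i \<bullet> u) / 2" for u
      by (simp add: inner_complex_def field_simps)
    have "?v \<bullet> normal_vec M i = height M i"
      unfolding half using h[OF i] n[OF i] by (simp add: height_def)
    moreover have "?v \<bullet> normal_vec M (Suc i) = height M (Suc i)"
    proof (cases "i = N")
      case False
      then have i': "Suc i \<in> {1..N}" using i by auto
      show ?thesis
        unfolding half using h[OF i'] n[OF i'] inner_normal_step[of \<Gamma> i] inner_normal_step[of \<Sigma> i] by simp
    next
      \<comment> \<open>The edge that follows the last vertex is the first one.\<close>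
      case True
      have one: "1 \<in> {1..N}" using len by auto
      have S: "vertex ws (Suc N) = vertex ws 1" "vertex ws N = vertex ws 0" if "length ws = N" for ws
        using that len by (auto simp: vertex_def mod_Suc)
      show ?thesis
        unfolding half using h[OF one] n[OF one] len True
          inner_normal_step[of \<Gamma> 0] inner_normal_step[of \<Sigma> 0] normal_vec_Suc_length[of M N]
        by (simp add: S height_def)
    qed
    ultimately show ?thesis
      using vertex_eqI[OF M] i len by metis
  qed
  show ?thesis
  proof (cases "j = 0")
    case True
    then show ?thesis using pos[of N] len vertex_length by (metis atLeastAtMost_iff le_refl less_eq_Suc_le One_nat_def)
  qed (use pos j N_def in auto)
qed

section \<open>The change of area in time\<close>

text \<open>The shoelace sum is a quadratic form in the vertices, and \<open>q(y) - q(x)\<close> is the derivative of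
  \<open>q\<close> at \<open>(x + y)/2\<close> in the direction \<open>y - x\<close>; so the first variation at the midpoint is exact.\<close>

theorem area_midpoint_rule:
  assumes \<Gamma>: "\<Gamma> \<in> polygon_class P" and \<Sigma>: "\<Sigma> \<in> polygon_class P" and M: "is_midpoint P \<Gamma> \<Sigma> M"
  shows "area \<Sigma> - area \<Gamma> = (\<Sum>j = 1..length P. edge_length M j * (height \<Sigma> j - height \<Gamma> j))"
proof -
  define N where "N = length P"
  define d where "d j = vertex \<Sigma> j - vertex \<Gamma> j" for j
  have len: "length M = N" "length \<Gamma> = N" "length \<Sigma> = N" 
    and n: "\<And>j. j \<in> {1..N} \<Longrightarrow> normal_vec \<Gamma> j = normal_vec M j \<and> normal_vec \<Sigma> j = normal_vec M j"
    and pol: "polygon \<Gamma>" "polygon \<Sigma>"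
    using assms by (auto simp: polygon_class_def is_midpoint_def N_def)
  have "(\<Sum>j = 1..N. edge_length M j * (height \<Sigma> j - height \<Gamma> j)) =
      (\<Sum>j = 1..N. cross2 (d (j - 1)) (vertex M j) + cross2 (vertex M (j - 1)) (d j)) / 2"
  proof (rule sum_edge_length_velocity[OF len(1)])
    show "d N = d 0" using len vertex_length[of \<Sigma>] vertex_length[of \<Gamma>] by (simp add: d_def)
    fix j assume j: "j \<in> {1..N}"
    show "d j \<bullet> normal_vec M j = height \<Sigma> j - height \<Gamma> j"
      using n[OF j] by (simp add: d_def height_def inner_diff_left)
    show "d (j - 1) \<bullet> normal_vec M j = height \<Sigma> j - height \<Gamma> j"
      using n[OF j] inner_normal_previous_vertex[of j \<Sigma>] inner_normal_previous_vertex[of j \<Gamma>] j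
      by (simp add: d_def inner_diff_left)
  qed
  also have "\<dots> = (\<Sum>j = 1..N. cross2 (vertex \<Sigma> (j - 1)) (vertex \<Sigma> j)
      - cross2 (vertex \<Gamma> (j - 1)) (vertex \<Gamma> j)) / 2"
  proof -
    have "cross2 (d (j - 1)) (vertex M j) + cross2 (vertex M (j - 1)) (d j) =
      cross2 (vertex \<Sigma> (j - 1)) (vertex \<Sigma> j) - cross2 (vertex \<Gamma> (j - 1)) (vertex \<Gamma> j)"
      if "j \<in> {1..N}" for j
    proof -
      have "j \<le> length P" "j - 1 \<le> length P" using that by (auto simp: N_def)
      then show ?thesis
        unfolding d_def by (simp only: vertex_midpoint[OF assms]) (simp add: cross2_def field_simps)
    qed
    then show ?thesis by simp
  qed
  also have "\<dots> = area \<Sigma> - area \<Gamma>"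
    using pol by (simp add: area_eq_shoelace shoelace_def len sum_subtractf diff_divide_distrib)
  finally show ?thesis by (simp add: N_def)
qed

text \<open>The normals do not depend on time, so both end points of an edge move with the normal
  velocity of that edge, and the first variation formula applies to the velocities of the vertices.\<close>

theorem area_has_derivative_of_motion:
  assumes "0 < T" and mot: "C1_polygonal_motion P T \<Gamma>" and t: "t \<in> {0..T}"
  shows "((\<lambda>s. area (\<Gamma> s)) has_real_derivative
           (\<Sum>j = 1..length P. edge_length (\<Gamma> t) j * normal_velocity T \<Gamma> t j)) (at t within {0..T})"
proof -
  define N where "N = length P"
  let ?F = "at t within {0..T}"
  have cls: "\<Gamma> s \<in> polygon_class P" if "s \<in> {0..T}" for s
    using mot that by (simp add: C1_polygonal_motion_def)
  have len: "length (\<Gamma> s) = N" "polygon (\<Gamma> s)" 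
    and n: "\<And>j. j \<in> {1..N} \<Longrightarrow> normal_vec (\<Gamma> s) j = normal_vec (\<Gamma> t) j" if "s \<in> {0..T}" for s
    using cls[OF that] cls[OF t] by (auto simp: polygon_class_def N_def)
  have N: "0 < N" using len[OF t] by (auto simp: polygon_def)
  have "\<forall>j \<in> {1..N}. \<exists>w'. ((\<lambda>s. vertex (\<Gamma> s) j) has_vector_derivative w') ?F"
    using mot t by (fastforce simp: C1_polygonal_motion_def N_def)
  then obtain w where w: "\<And>j. j \<in> {1..N} \<Longrightarrow> ((\<lambda>s. vertex (\<Gamma> s) j) has_vector_derivative w j) ?F"
    by metis
  \<comment> \<open>The motion specifies velocities for the vertices \<open>1, \<dots>, N\<close>, while the first edge starts at
    vertex \<open>0\<close>, which is vertex \<open>N\<close>.\<close>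
  define d where "d j = (if j = 0 then w N else w j)" for j
  have d: "((\<lambda>s. vertex (\<Gamma> s) j) has_vector_derivative d j) ?F" if "j \<le> N" for j
  proof (cases "j = 0")
    case False
    then show ?thesis using w[of j] that by (simp add: d_def)
  next
    case True
    have "((\<lambda>s. vertex (\<Gamma> s) N) has_vector_derivative w N) ?F" using w[of N] N by simp
    then have "((\<lambda>s. vertex (\<Gamma> s) 0) has_vector_derivative w N) ?F"
      by (rule has_vector_derivative_transform[OF t, rotated])
         (use len vertex_length in metis)
    then show ?thesis using True by (simp add: d_def)
  qed
  have V: "d j \<bullet> normal_vec (\<Gamma> t) j = normal_velocity T \<Gamma> t j"
    "d (j - 1) \<bullet> normal_vec (\<Gamma> t) j = normal_velocity T \<Gamma> t j" if j: "j \<in> {1..N}" for j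
  proof -
    have vel: "normal_velocity T \<Gamma> t j = d i \<bullet> normal_vec (\<Gamma> t) j"
      if "i \<le> N" and h: "\<And>s. s \<in> {0..T} \<Longrightarrow> height (\<Gamma> s) j = vertex (\<Gamma> s) i \<bullet> normal_vec (\<Gamma> t) j" for i
    proof -
      have "((\<lambda>s. vertex (\<Gamma> s) i \<bullet> normal_vec (\<Gamma> t) j) has_vector_derivative d i \<bullet> normal_vec (\<Gamma> t) j) ?F"
        by (rule bounded_linear.has_vector_derivative[OF bounded_linear_inner_left d[OF \<open>i \<le> N\<close>]])
      then have "((\<lambda>s. height (\<Gamma> s) j) has_vector_derivative d i \<bullet> normal_vec (\<Gamma> t) j) ?F"
        by (rule has_vector_derivative_transform[OF t, rotated]) (use h in simp)
      then show ?thesis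
        unfolding normal_velocity_def using \<open>0 < T\<close> t
        by (metis vector_derivative_within_cbox cbox_interval)
    qed
    show "d j \<bullet> normal_vec (\<Gamma> t) j = normal_velocity T \<Gamma> t j"
      by (rule vel[symmetric]) (use j n in \<open>auto simp: height_def\<close>)
    show "d (j - 1) \<bullet> normal_vec (\<Gamma> t) j = normal_velocity T \<Gamma> t j"
      using j n inner_normal_previous_vertex[of j] by (intro vel[symmetric]) (auto, metis)
  qed
  let ?v = "\<lambda>s. vertex (\<Gamma> s)"
  have cross_deriv: "((\<lambda>s. cross2 (?v s i) (?v s j)) has_real_derivative
      cross2 (d i) (?v t j) + cross2 (?v t i) (d j)) ?F" if "i \<le> N" "j \<le> N" for i j
  proof -
    note dR = bounded_linear.has_vector_derivative[OF bounded_linear_Re d]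
    note dI = bounded_linear.has_vector_derivative[OF bounded_linear_Im d]
    show ?thesis
      unfolding cross2_def
      by (rule derivative_eq_intros dR[OF that(1), folded has_real_derivative_iff_has_vector_derivative]
           dR[OF that(2), folded has_real_derivative_iff_has_vector_derivative]
           dI[OF that(1), folded has_real_derivative_iff_has_vector_derivative]
           dI[OF that(2), folded has_real_derivative_iff_has_vector_derivative] refl)+ simp
  qed
  have "((\<lambda>s. (\<Sum>j = 1..N. cross2 (?v s (j - 1)) (?v s j)) / 2) has_real_derivative
      (\<Sum>j = 1..N. cross2 (d (j - 1)) (?v t j) + cross2 (?v t (j - 1)) (d j)) / 2) ?F"
    by (intro DERIV_cdivide DERIV_sum cross_deriv) auto
  also have "(\<Sum>j = 1..N. cross2 (d (j - 1)) (?v t j) + cross2 (?v t (j - 1)) (d j)) / 2 =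
      (\<Sum>j = 1..N. edge_length (\<Gamma> t) j * normal_velocity T \<Gamma> t j)"
    by (rule sum_edge_length_velocity[symmetric]) (use len[OF t] N V in \<open>auto simp: d_def\<close>)
  finally show ?thesis
    unfolding N_def[symmetric]
    by (rule has_field_derivative_transform_within[OF _ zero_less_one t])
       (simp add: area_eq_shoelace shoelace_def len)
qed

theorem proposition4p4:
  fixes P\<^sub>0 :: "complex list" and \<O> :: "complex list set" and Ts :: ereal and T \<mu> :: real
    and F :: "complex list \<Rightarrow> real \<Rightarrow> nat \<Rightarrow> real"
    and t :: "nat \<Rightarrow> real" and mbar N :: nat
    and \<Gamma>\<^sub>0 :: "complex list" and \<Gamma> :: "nat \<Rightarrow> complex list"
  assumes "polygon P\<^sub>0" and "length P\<^sub>0 = N"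
    and "openin (class_topology P\<^sub>0) \<O>"
    and "0 < T" and "ereal T < Ts"
    and "continuous_force P\<^sub>0 \<O> Ts F"
    and "locally_lipschitz_force P\<^sub>0 \<O> Ts F"
    and "\<And>\<Sigma> s. \<Sigma> \<in> \<O> \<Longrightarrow> s \<in> time_interval Ts \<Longrightarrow> (\<Sum>j = 1..N. edge_length \<Sigma> j * F \<Sigma> s j) = \<mu>"
    and "t 0 = 0" and "\<And>m. m < mbar \<Longrightarrow> t m < t (Suc m)" and "t mbar \<le> T"
    and "\<Gamma>\<^sub>0 \<in> \<O>"
    and "scheme_solution P\<^sub>0 \<O> F t mbar \<Gamma>\<^sub>0 \<Gamma>"
  shows "(\<forall>m < mbar. area (\<Gamma> (Suc m)) = area (\<Gamma> m) + \<mu> * (t (Suc m) - t m)) \<and>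
    (\<forall>\<Gamma>x. exact_solution P\<^sub>0 \<O> F T \<Gamma>\<^sub>0 \<Gamma>x \<longrightarrow> (\<forall>m \<le> mbar. area (\<Gamma> m) = area (\<Gamma>x (t m))))"
proof -
  have sub: "\<O> \<subseteq> polygon_class P\<^sub>0"
    using openin_subset[OF assms(3)] Metric_space.topspace_mtopology[OF Metric_space_polygon_class[OF assms(1)]]
    by simp
  have mono: "t k \<le> t m" if "k \<le> m" "m \<le> mbar" for k m
    using that by (induction rule: dec_induct) (use assms(10) in \<open>auto intro: less_imp_le order.trans simp: Suc_le_eq\<close>)
  have t: "t m \<in> {0..T}" if "m \<le> mbar" for m
    using mono[of 0 m] mono[of m mbar] that assms(9,11) by simp
  have time: "s \<in> time_interval Ts" if "s \<in> {0..T}" for s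
    using that assms(5) by (auto simp: time_interval_def intro: le_less_trans[of _ "ereal T"])
  have \<Gamma>: "\<Gamma> m \<in> \<O>" if "m \<le> mbar" for m
    using that assms(12,13) by (cases "m = 0") (auto simp: scheme_solution_def)
  have step: "area (\<Gamma> (Suc m)) = area (\<Gamma> m) + \<mu> * (t (Suc m) - t m)" if m: "m < mbar" for m
  proof -
    define \<tau> where "\<tau> = t (Suc m) - t m"
    define s where "s = (t m + t (Suc m)) / 2"
    have "\<tau> > 0" using assms(10)[OF m] by (simp add: \<tau>_def)
    obtain M where M: "M \<in> \<O>" "is_midpoint P\<^sub>0 (\<Gamma> m) (\<Gamma> (Suc m)) M"
      and "\<And>j. j \<in> {1..N} \<Longrightarrow> (height (\<Gamma> (Suc m)) j - height (\<Gamma> m) j) / \<tau> = F M s j"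
      using assms(13) m unfolding scheme_solution_def \<tau>_def s_def assms(2) by blast
    then have h: "height (\<Gamma> (Suc m)) j - height (\<Gamma> m) j = \<tau> * F M s j" if "j \<in> {1..N}" for j
      using that \<open>\<tau> > 0\<close> by (metis nonzero_mult_div_cancel_left times_divide_eq_right less_irrefl)
    have "s \<in> {0..T}" using t[of m] t[of "Suc m"] m by (simp add: s_def)
    have "area (\<Gamma> (Suc m)) - area (\<Gamma> m) =
        (\<Sum>j = 1..N. edge_length M j * (height (\<Gamma> (Suc m)) j - height (\<Gamma> m) j))"
      using area_midpoint_rule[OF _ _ M(2)] \<Gamma> sub m assms(2) by (simp add: subset_eq)
    also have "\<dots> = \<tau> * (\<Sum>j = 1..N. edge_length M j * F M s j)"
      using h by (simp add: sum_distrib_left mult.left_commute)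
    also have "\<dots> = \<tau> * \<mu>"
      using assms(8)[OF M(1) time[OF \<open>s \<in> {0..T}\<close>]] by simp
    finally show ?thesis by (simp add: \<tau>_def algebra_simps)
  qed
  have discrete: "area (\<Gamma> m) = area \<Gamma>\<^sub>0 + \<mu> * t m" if "m \<le> mbar" for m
    using that
  proof (induction m)
    case 0
    then show ?case using assms(9,13) by (simp add: scheme_solution_def)
  next
    case (Suc m)
    then show ?case using step[of m] by (simp add: algebra_simps)
  qed
  have "area (\<Gamma>x s) = area \<Gamma>\<^sub>0 + \<mu> * s" if ex: "exact_solution P\<^sub>0 \<O> F T \<Gamma>\<^sub>0 \<Gamma>x" and s: "s \<in> {0..T}" for \<Gamma>x s
  proof -
    have mot: "C1_polygonal_motion P\<^sub>0 T \<Gamma>x" and "\<Gamma>x 0 = \<Gamma>\<^sub>0"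
      using ex by (auto simp: exact_solution_def)
    have der: "((\<lambda>r. area (\<Gamma>x r)) has_real_derivative \<mu>) (at r within {0..T})" if r: "r \<in> {0..T}" for r
    proof -
      have "(\<Sum>j = 1..length P\<^sub>0. edge_length (\<Gamma>x r) j * normal_velocity T \<Gamma>x r j) =
          (\<Sum>j = 1..N. edge_length (\<Gamma>x r) j * F (\<Gamma>x r) r j)"
        using ex r assms(2) by (simp add: exact_solution_def)
      also have "\<dots> = \<mu>"
        using ex r time[OF r] by (intro assms(8)) (auto simp: exact_solution_def)
      finally show ?thesis
        using area_has_derivative_of_motion[OF \<open>0 < T\<close> mot r] by simp
    qed
    have "((\<lambda>r. area (\<Gamma>x r) - \<mu> * r) has_real_derivative 0) (at r within {0..T})" if "r \<in> {0..T}" for r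
      by (rule derivative_eq_intros der[OF that] refl)+ simp
    then obtain c where "\<And>r. r \<in> {0..T} \<Longrightarrow> area (\<Gamma>x r) - \<mu> * r = c"
      using has_field_derivative_zero_constant[of "{0..T}" "\<lambda>r. area (\<Gamma>x r) - \<mu> * r"] by auto
    from this[of 0] this[OF s] show ?thesis using \<open>\<Gamma>x 0 = \<Gamma>\<^sub>0\<close> \<open>0 < T\<close> by simp
  qed
  with step discrete t show ?thesis by simp
qed

end
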